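(* Let $G$ be a finite loopless graph on $n$ vertices with $c$ connected components. The maximal number of colors used in a Gallai coloring of $G$ is $n-c$.
   Context: A Gallai coloring of a graph $G=(V,E)$ is a function $\varepsilon$ from $E$ to a set of colors such that no cycle of $G$ is rainbow, i.e. on every cycle at least two edges have the same color (equivalently, for every circuit $X$ of the graphic matroid of $G$, $|\varepsilon(X)|<|X|$). The number of colors used is $|\varepsilon(E)|$. *)

theory Defs
  imports Main
begin

(* Undirected multigraphs: parallel edges are distinct elements of edges with the same set of
   ends, and a loop is an edge whose set of ends is a singleton. *)
record ('v, 'e) multigraph =
  verts :: "'v set"
  edges :: "'e set"
  ends :: "'e \<Rightarrow> 'v set"

definition multigraph :: "('v, 'e) multigraph \<Rightarrow> bool" where
  "multigraph G \<longleftrightarrow> (\<forall>e\<in>edges G. ends G e \<subseteq> verts G \<and> card (ends G e) \<in> {1, 2})"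

definition finite_graph :: "('v, 'e) multigraph \<Rightarrow> bool" where
  "finite_graph G \<longleftrightarrow> multigraph G \<and> finite (verts G) \<and> finite (edges G)"

definition loopless :: "('v, 'e) multigraph \<Rightarrow> bool" where
  "loopless G \<longleftrightarrow> (\<forall>e\<in>edges G. card (ends G e) \<noteq> 1)"

(* The edge es ! i joins vs ! i to its cyclic successor.  Length 1 is a loop and length 2 a pair
   of parallel edges; these are circuits of the graphic matroid and so count as cycles. *)
definition cycle :: "('v, 'e) multigraph \<Rightarrow> 'v list \<Rightarrow> 'e list \<Rightarrow> bool" where
  "cycle G vs es \<longleftrightarrow>
     es \<noteq> [] \<and> length vs = length es \<and>
     distinct vs \<and> set vs \<subseteq> verts G \<and>
     distinct es \<and> set es \<subseteq> edges G \<and>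
     (\<forall>i<length es. ends G (es ! i) = {vs ! i, vs ! (Suc i mod length es)})"

definition rainbow :: "('e \<Rightarrow> 'c) \<Rightarrow> 'e set \<Rightarrow> bool" where
  "rainbow \<epsilon> X \<longleftrightarrow> inj_on \<epsilon> X"

(* Values of the coloring outside edges G play no role. *)
definition gallai_coloring :: "('v, 'e) multigraph \<Rightarrow> ('e \<Rightarrow> 'c) \<Rightarrow> bool" where
  "gallai_coloring G \<epsilon> \<longleftrightarrow> (\<forall>vs es. cycle G vs es \<longrightarrow> \<not> rainbow \<epsilon> (set es))"

definition num_colors :: "('v, 'e) multigraph \<Rightarrow> ('e \<Rightarrow> 'c) \<Rightarrow> nat" where
  "num_colors G \<epsilon> = card (\<epsilon> ` edges G)"

definition adj :: "('v, 'e) multigraph \<Rightarrow> ('v \<times> 'v) set" where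
  "adj G = {(u, v). u \<in> verts G \<and> v \<in> verts G \<and> (\<exists>e\<in>edges G. ends G e = {u, v})}"

definition connected_components :: "('v, 'e) multigraph \<Rightarrow> 'v set set" where
  "connected_components G = verts G // {(u, v) \<in> verts G \<times> verts G. (u, v) \<in> (adj G)\<^sup>*}"

end

theory Submission
  imports Defs
begin

text \<open>
  Upper bound: one edge of each color gives a set of edges without a cycle, and adding the edges of
  such a set one at a time merges two components each time.

  Attained: rank the vertices and give every edge the larger rank of its two ends. The
  two edges of a cycle at its vertex of largest rank share their color. If the rank is injective and refines the
  distance to a root chosen in each component, the rank of every vertex that is not a root is a
  color, because such a vertex has a neighbour closer to the root.
\<close>

section \<open>Counting equivalence classes\<close>

text \<open>Sending each class of \<open>R\<close> to the class of \<open>S\<close> containing it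
  maps onto \<open>A // S\<close>. Equal finite cardinalities would make this map injective, and
  then \<open>S\<close>-related points would already be \<open>R\<close>-related. This gives the
  strict drop in components when an edge joins two of them.\<close>

lemma card_quotient_less:
  assumes "equiv A R" "equiv A S" "R \<subset> S" "finite A"
  shows "card (A // S) < card (A // R)"
proof -
  have fin: "finite (A // R)"
    using assms by (simp add: equiv_type finite_quotient)
  have class_image: "S `` (R `` {x}) = S `` {x}" if "x \<in> A" for x
    using that assms by (metis psubset_imp_subset refines_equiv_class_eq2)
  have image: "(\<lambda>C. S `` C) ` (A // R) = A // S"
  proof -
    have "A // R = (\<lambda>x. R `` {x}) ` A" "A // S = (\<lambda>x. S `` {x}) ` A"
      by (auto simp: quotient_def)
    then show ?thesis
      by (simp add: image_image class_image)
  qed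
  have "card (A // S) \<noteq> card (A // R)"
  proof
    assume "card (A // S) = card (A // R)"
    then have inj: "inj_on (\<lambda>C. S `` C) (A // R)"
      using image fin by (simp add: eq_card_imp_inj_on)
    have "S \<subseteq> R"
    proof clarify
      fix x y assume xy: "(x, y) \<in> S"
      then have A: "x \<in> A" "y \<in> A"
        using assms(2) equiv_type by blast+
      have "S `` (R `` {x}) = S `` (R `` {y})"
        using xy A assms(2) by (simp add: class_image equiv_class_eq)
      then have "R `` {x} = R `` {y}"
        using inj A by (simp add: inj_on_def quotientI)
      then show "(x, y) \<in> R"
        using A assms(1) by (simp add: eq_equiv_class_iff)
    qed
    with assms(3) show False by blast
  qed
  moreover have "card (A // S) \<le> card (A // R)"
    using image fin by (metis card_image_le)
  ultimately show ?thesis by simp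
qed

section \<open>Reachability and components\<close>

text \<open>Restricting to vertices makes this an equivalence on \<open>verts G\<close>;
  \<open>(adj G)\<^sup>*\<close> alone also relates each non-vertex to itself.\<close>

definition reachable :: "('v, 'e) multigraph \<Rightarrow> ('v \<times> 'v) set" where
  "reachable G = {(u, v) \<in> verts G \<times> verts G. (u, v) \<in> (adj G)\<^sup>*}"

lemma connected_components_eq: "connected_components G = verts G // reachable G"
  by (simp add: connected_components_def reachable_def)

lemma sym_adj: "sym (adj G)"
  by (auto simp: sym_def adj_def insert_commute)

lemma equiv_reachable: "equiv (verts G) (reachable G)"
proof (rule equivI)
  show "reachable G \<subseteq> verts G \<times> verts G" by (auto simp: reachable_def)
  show "refl_on (verts G) (reachable G)" by (auto simp: refl_on_def reachable_def)
  show "sym (reachable G)"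
    using sym_rtrancl[OF sym_adj, of G] by (auto simp: sym_def reachable_def)
  show "trans (reachable G)" by (auto simp: trans_def reachable_def)
qed

lemma adj_mono: "F \<subseteq> F' \<Longrightarrow> adj (G\<lparr>edges := F\<rparr>) \<subseteq> adj (G\<lparr>edges := F'\<rparr>)"
  by (auto simp: adj_def)

lemma reachable_mono: "F \<subseteq> F' \<Longrightarrow> reachable (G\<lparr>edges := F\<rparr>) \<subseteq> reachable (G\<lparr>edges := F'\<rparr>)"
  using rtrancl_mono[OF adj_mono[of F F' G]] by (auto simp: reachable_def)

section \<open>Paths, cycles and forests\<close>

text \<open>A walk of least length cannot repeat a vertex: if \<open>f i = f j\<close> with
  \<open>i < j\<close>, cutting out the stretch between them leaves a shorter walk.\<close>

lemma shortest_path: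
  assumes "(u, v) \<in> r\<^sup>*"
  obtains n f where "f 0 = u" "f n = v" "\<forall>i<n. (f i, f (Suc i)) \<in> r" "inj_on f {..n}"
proof -
  define n where "n = (LEAST n. (u, v) \<in> r ^^ n)"
  have n: "(u, v) \<in> r ^^ n"
    unfolding n_def using assms by (metis LeastI rtrancl_imp_relpow)
  have least: "n \<le> m" if "(u, v) \<in> r ^^ m" for m
    unfolding n_def using that by (rule Least_le)
  obtain f where f: "f 0 = u" "f n = v" "\<forall>i<n. (f i, f (Suc i)) \<in> r"
    using n by (auto simp: relpow_fun_conv)
  have "f i \<noteq> f j" if "i < j" "j \<le> n" for i j
  proof
    assume eq: "f i = f j"
    have "(u, f i) \<in> r ^^ i"
      unfolding relpow_fun_conv using f that by (intro exI[of _ f]) auto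
    moreover have "(f i, v) \<in> r ^^ (n - j)"
      unfolding relpow_fun_conv using f that eq by (intro exI[of _ "\<lambda>k. f (k + j)"]) auto
    ultimately have "(u, v) \<in> r ^^ (i + (n - j))"
      by (auto simp: relpow_add)
    with least that show False by fastforce
  qed
  then have "inj_on f {..n}"
    by (intro linorder_inj_onI) auto
  with f show ?thesis using that by blast
qed

text \<open>A shortest path from \<open>u\<close> to \<open>v\<close> in \<open>F\<close> is closed
  up by \<open>e\<close>. Its vertices are distinct by minimality, and \<open>e\<close> is a new
  edge because it lies outside \<open>F\<close>.\<close>

lemma cycle_of_reachable_ends:
  assumes e: "e \<notin> F" "ends G e = {u, v}" "u \<noteq> v"
    and reach: "(u, v) \<in> reachable (G\<lparr>edges := F\<rparr>)"
  obtains vs es where "cycle (G\<lparr>edges := insert e F\<rparr>) vs es"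
proof -
  let ?H = "G\<lparr>edges := F\<rparr>"
  have uv: "u \<in> verts G" "v \<in> verts G" "(u, v) \<in> (adj ?H)\<^sup>*"
    using reach by (auto simp: reachable_def)
  obtain n f where f: "f 0 = u" "f n = v" "\<forall>i<n. (f i, f (Suc i)) \<in> adj ?H"
    and inj: "inj_on f {..n}"
    using shortest_path[OF uv(3)] by metis
  have "\<exists>a. a \<in> F \<and> ends G a = {f i, f (Suc i)}" if "i < n" for i
    using f(3) that by (auto simp: adj_def)
  then obtain g where g: "\<And>i. i < n \<Longrightarrow> g i \<in> F" "\<And>i. i < n \<Longrightarrow> ends G (g i) = {f i, f (Suc i)}"
    by metis
  have verts: "f i \<in> verts G" if "i \<le> n" for i
    using that f(2,3) uv(2) by (cases "i = n") (auto simp: adj_def)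
  have inj_g: "inj_on g {..<n}"
  proof (rule linorder_inj_onI)
    fix i j assume ij: "i < j" "i \<in> {..<n}" "j \<in> {..<n}"
    \<comment> \<open>\<open>f i\<close> is an end of \<open>g i\<close> but not of
      \<open>g j\<close>, whose ends have the larger indices \<open>j\<close> and
      \<open>Suc j\<close>.\<close>
    have "f i \<noteq> f j" "f i \<noteq> f (Suc j)"
      using ij by (simp_all add: inj_on_eq_iff[OF inj])
    then show "g i \<noteq> g j"
      using g(2)[of i] g(2)[of j] ij by auto
  qed auto
  have nth: "(map g [0..<n] @ [e]) ! i = (if i < n then g i else e)" if "i \<le> n" for i
    using that by (auto simp: nth_append)
  have nth': "map f [0..<Suc n] ! i = f i" if "i \<le> n" for i
    using that nth_map_upt[of i "Suc n" 0 f] by (simp del: upt_Suc)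
  have "cycle (G\<lparr>edges := insert e F\<rparr>) (map f [0..<Suc n]) (map g [0..<n] @ [e])"
    unfolding cycle_def
  proof (intro conjI allI impI)
    show "distinct (map f [0..<Suc n])"
      using inj by (simp add: distinct_map atLeast0LessThan lessThan_Suc_atMost del: upt_Suc)
    show "distinct (map g [0..<n] @ [e])"
      using inj_g g(1) e(1) by (auto simp: distinct_map atLeast0LessThan)
    fix i assume "i < length (map g [0..<n] @ [e])"
    \<comment> \<open>At \<open>i = n\<close> the successor index wraps to 0, so the closing edge
      \<open>e\<close> joins \<open>f n = v\<close> to \<open>f 0 = u\<close>.\<close>
    then have "i < n \<or> i = n" by auto
    then show "ends (G\<lparr>edges := insert e F\<rparr>) ((map g [0..<n] @ [e]) ! i) =
      {map f [0..<Suc n] ! i, map f [0..<Suc n] ! (Suc i mod length (map g [0..<n] @ [e]))}"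
      using g(2) e(2) f(1,2) by (auto simp: nth nth' simp del: upt_Suc)
  qed (use g(1) verts in auto)
  then show ?thesis using that by blast
qed

lemma cycle_mono: "cycle (G\<lparr>edges := F\<rparr>) vs es \<Longrightarrow> F \<subseteq> F' \<Longrightarrow> cycle (G\<lparr>edges := F'\<rparr>) vs es"
  by (auto simp: cycle_def)

lemma loopless_ends:
  assumes "finite_graph G" "loopless G" "e \<in> edges G"
  obtains u v where "ends G e = {u, v}" "u \<noteq> v" "u \<in> verts G" "v \<in> verts G"
proof -
  have "card (ends G e) = 2" "ends G e \<subseteq> verts G"
    using assms by (auto simp: finite_graph_def multigraph_def loopless_def)
  then show ?thesis using that by (auto simp: card_2_iff)
qed

text \<open>Induction on \<open>F\<close>: a new edge with already connected ends would close a
  cycle, so each insertion strictly enlarges reachability and lowers the number of components by at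
  least one.\<close>

lemma card_forest_le:
  assumes G: "finite_graph G" "loopless G"
    and "finite F" "F \<subseteq> edges G" "\<And>vs es. \<not> cycle (G\<lparr>edges := F\<rparr>) vs es"
  shows "card F + card (connected_components (G\<lparr>edges := F\<rparr>)) \<le> card (verts G)"
  using assms(3-5)
proof (induction F)
  case empty
  have "connected_components H = (\<lambda>x. reachable H `` {x}) ` verts H" for H :: "('a, 'b) multigraph"
    by (auto simp: connected_components_eq quotient_def)
  then show ?case
    using G by (simp add: finite_graph_def card_image_le)
next
  case (insert e F)
  let ?H = "G\<lparr>edges := F\<rparr>" and ?H' = "G\<lparr>edges := insert e F\<rparr>"
  obtain u v where uv: "ends G e = {u, v}" "u \<noteq> v" "u \<in> verts G" "v \<in> verts G"
    using loopless_ends[OF G, of e] insert.prems by blast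
  have "(u, v) \<notin> reachable ?H"
    using cycle_of_reachable_ends[OF insert.hyps(2) uv(1,2)] insert.prems(2) by blast
  moreover have "(u, v) \<in> reachable ?H'"
    using uv by (auto simp: reachable_def adj_def)
  ultimately have "reachable ?H \<subset> reachable ?H'"
    using reachable_mono[of F "insert e F" G] by blast
  then have "card (connected_components ?H') < card (connected_components ?H)"
    using card_quotient_less[of "verts G" "reachable ?H" "reachable ?H'"] G
      equiv_reachable[of ?H] equiv_reachable[of ?H']
    by (simp add: connected_components_eq finite_graph_def)
  moreover have "card F + card (connected_components ?H) \<le> card (verts G)"
    using insert.IH insert.prems cycle_mono[of F G _ _ "insert e F"] by blast
  ultimately show ?case
    using insert.hyps by simp
qed

section \<open>Upper bound on the number of colors\<close>

lemma num_colors_le: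
  assumes G: "finite_graph G" "loopless G" and "gallai_coloring G \<epsilon>"
  shows "num_colors G \<epsilon> \<le> card (verts G) - card (connected_components G)"
proof -
  \<comment> \<open>\<open>F\<close> picks one edge of each color, so every cycle inside
    \<open>F\<close> would be rainbow.\<close>
  have "\<exists>F \<subseteq> edges G. \<epsilon> ` F = \<epsilon> ` edges G \<and> inj_on \<epsilon> F"
    using subset_image_inj[of "\<epsilon> ` edges G" \<epsilon> "edges G"] by (metis subset_refl)
  then obtain F where F: "F \<subseteq> edges G" "\<epsilon> ` F = \<epsilon> ` edges G" "inj_on \<epsilon> F"
    by auto
  have "\<not> cycle (G\<lparr>edges := F\<rparr>) vs es" for vs es
  proof
    assume cyc: "cycle (G\<lparr>edges := F\<rparr>) vs es"
    then have "rainbow \<epsilon> (set es)"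
      using inj_on_subset[OF F(3)] by (simp add: cycle_def rainbow_def)
    then show False
      using cycle_mono[OF cyc F(1)] assms(3) by (simp add: gallai_coloring_def)
  qed
  moreover have "finite F"
    using finite_subset[OF F(1)] G(1) by (simp add: finite_graph_def)
  ultimately have "card F + card (connected_components (G\<lparr>edges := F\<rparr>)) \<le> card (verts G)"
    using card_forest_le G F(1) by blast
  \<comment> \<open>Dropping edges can only split components, so the bound for \<open>F\<close>
    carries over to \<open>G\<close>.\<close>
  moreover have "card (connected_components G) \<le> card (connected_components (G\<lparr>edges := F\<rparr>))"
  proof -
    have "reachable (G\<lparr>edges := F\<rparr>) \<subseteq> reachable G"
      using reachable_mono[OF F(1), of G] by simp
    then show ?thesis
      using finite_quotient[OF _ equiv_type[OF equiv_reachable[of "G\<lparr>edges := F\<rparr>"]]]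
        finite_refines_card_le[of "verts G" "reachable (G\<lparr>edges := F\<rparr>)" "reachable G"]
        equiv_reachable[of "G\<lparr>edges := F\<rparr>"] equiv_reachable[of G] G(1)
      by (simp add: connected_components_eq finite_graph_def)
  qed
  moreover have "num_colors G \<epsilon> = card F"
    using card_image[OF F(3)] F(2) by (simp add: num_colors_def)
  ultimately show ?thesis by simp
qed

section \<open>A coloring attaining the bound\<close>

lemma gallai_coloring_Max_rank:
  fixes f :: "'v \<Rightarrow> nat" and G :: "('v, 'e) multigraph"
  assumes "loopless G"
  shows "gallai_coloring G (\<lambda>e. Max (f ` ends G e))"
  unfolding gallai_coloring_def
proof (intro allI impI notI)
  fix vs es
  assume cyc: "cycle G vs es" and rb: "rainbow (\<lambda>e. Max (f ` ends G e)) (set es)"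
  define n where "n = length es"
  have n: "n > 0" "length vs = n" and es: "distinct es" "set es \<subseteq> edges G"
    and ends: "\<And>i. i < n \<Longrightarrow> ends G (es ! i) = {vs ! i, vs ! (Suc i mod n)}"
    using cyc by (auto simp: cycle_def n_def)
  \<comment> \<open>A cycle of length 1 is a loop; from length 2 on, two different edges of the
    cycle meet at each of its vertices.\<close>
  have "n \<noteq> 1"
  proof
    assume "n = 1"
    then have "card (ends G (es ! 0)) = 1"
      using ends[of 0] by simp
    moreover have "es ! 0 \<in> edges G"
      using es(2) n(1) n_def nth_mem by blast
    ultimately show False using assms by (simp add: loopless_def)
  qed
  then have "n \<ge> 2" using n by simp
  obtain m where m: "m < n" and max: "\<And>i. i < n \<Longrightarrow> f (vs ! i) \<le> f (vs ! m)"
  proof -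
    have fin: "finite ((\<lambda>i. f (vs ! i)) ` {..<n})" and "(\<lambda>i. f (vs ! i)) ` {..<n} \<noteq> {}"
      using n(1) by auto
    from Max_in[OF this] obtain m where
      "m < n" "Max ((\<lambda>i. f (vs ! i)) ` {..<n}) = f (vs ! m)"
      by auto
    with Max_ge[OF fin] show ?thesis
      using that[of m] by auto
  qed
  \<comment> \<open>\<open>p\<close> is the cyclic predecessor of \<open>m\<close>, so
    \<open>es ! p\<close> and \<open>es ! m\<close> are the two cycle edges at
    \<open>vs ! m\<close>.\<close>
  define p where "p = (if m = 0 then n - 1 else m - 1)"
  have p: "p < n" "Suc p mod n = m" "p \<noteq> m"
    using m \<open>n \<ge> 2\<close> by (auto simp: p_def)
  have "Max (f ` ends G (es ! m)) = f (vs ! m)" "Max (f ` ends G (es ! p)) = f (vs ! m)"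
    using max[of p] max[of "Suc m mod n"] m p n(1) by (simp_all add: ends max.absorb1 max.absorb2)
  then have "es ! m = es ! p"
    using rb m p(1) by (simp add: rainbow_def inj_on_def n_def)
  then show False
    using es(1) m p by (simp add: nth_eq_iff_index_eq n_def)
qed

text \<open>\<open>R\<close> is the set of chosen roots, at most one per component. The last step of
  a shortest walk from the root to any other vertex starts at a neighbour closer to the
  root.\<close>

lemma ex_rank:
  assumes fin: "finite (verts G)"
  obtains f :: "'v \<Rightarrow> nat" and R where "inj_on f (verts G)" "R \<subseteq> verts G"
    "card R \<le> card (connected_components (G :: ('v, 'e) multigraph))"
    "\<forall>v \<in> verts G - R. \<exists>w. (w, v) \<in> adj G \<and> f w < f v"
proof -
  \<comment> \<open>The choice depends only on the class of \<open>v\<close>, so vertices of one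
    component share their root.\<close>
  define root where "root v = (SOME u. u \<in> reachable G `` {v})" for v
  define d where "d v = (LEAST k. (root v, v) \<in> adj G ^^ k)" for v
  obtain N :: nat and g where g: "g ` verts G = {i. i < N}" "inj_on g (verts G)"
    using finite_imp_inj_to_nat_seg[OF fin] by auto
  \<comment> \<open>Lexicographic order: distance first, then the numbering \<open>g\<close>. As
    \<open>g\<close> stays below \<open>N\<close> on vertices, a smaller distance always wins, and
    \<open>f v mod N\<close> recovers \<open>g v\<close>.\<close>
  define f where "f v = d v * N + g v" for v
  have reach_root: "(root v, v) \<in> (adj G)\<^sup>*" if "v \<in> verts G" for v
  proof -
    have "root v \<in> reachable G `` {v}"
      unfolding root_def using that equiv_reachable[of G]
      by (metis equiv_class_self someI)
    then have "(v, root v) \<in> (adj G)\<^sup>*" by (simp add: reachable_def)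
    then show ?thesis using sym_rtrancl[OF sym_adj, of G] by (meson symD)
  qed
  have lower: "\<exists>w. (w, v) \<in> adj G \<and> f w < f v" if v: "v \<in> verts G" "root v \<noteq> v" for v
  proof -
    have dv: "(root v, v) \<in> adj G ^^ d v"
      unfolding d_def using reach_root[OF v(1)] by (metis LeastI rtrancl_imp_relpow)
    \<comment> \<open>Distance 0 would mean \<open>root v = v\<close>, since the zeroth power of a
      relation is the identity.\<close>
    with v(2) obtain k where k: "d v = Suc k"
      by (cases "d v") auto
    with dv obtain w where w: "(root v, w) \<in> adj G ^^ k" "(w, v) \<in> adj G"
      by auto
    have w_verts: "w \<in> verts G" using w(2) by (auto simp: adj_def)
    have "(w, v) \<in> reachable G"
      using w(2) by (auto simp: adj_def reachable_def)
    then have "root w = root v"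
      unfolding root_def using equiv_class_eq[OF equiv_reachable] by metis
    then have "d w \<le> k"
      unfolding d_def[of w] using w(1) by (simp add: Least_le)
    then have "d w * N \<le> k * N" by simp
    moreover have "g w < N" using g(1) w_verts by blast
    ultimately have "f w < f v"
      unfolding f_def k mult_Suc by linarith
    with w(2) show ?thesis by blast
  qed
  have "inj_on f (verts G)"
  proof (rule inj_onI)
    fix x y assume xy: "x \<in> verts G" "y \<in> verts G" "f x = f y"
    have "g x < N" "g y < N" using g(1) xy by auto
    then have "f x mod N = g x" "f y mod N = g y" by (simp_all add: f_def)
    with xy g(2) show "x = y" by (simp add: inj_on_def)
  qed
  moreover have "{v \<in> verts G. root v = v} \<subseteq> verts G"
    by blast
  moreover have "card {v \<in> verts G. root v = v} \<le> card (connected_components G)"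
  proof (rule card_inj_on_le)
    \<comment> \<open>A vertex that is its own root is determined by its class.\<close>
    show "inj_on (\<lambda>v. reachable G `` {v}) {v \<in> verts G. root v = v}"
    proof (rule inj_onI)
      fix x y
      assume x: "x \<in> {v \<in> verts G. root v = v}" and y: "y \<in> {v \<in> verts G. root v = v}"
      assume classes: "reachable G `` {x} = reachable G `` {y}"
      have "x = root x" using x by simp
      also have "\<dots> = root y" unfolding root_def classes ..
      also have "\<dots> = y" using y by simp
      finally show "x = y" .
    qed
    show "(\<lambda>v. reachable G `` {v}) ` {v \<in> verts G. root v = v} \<subseteq> connected_components G"
      unfolding connected_components_eq by (blast intro: quotientI)
    show "finite (connected_components G)"
      using finite_quotient[OF fin equiv_type[OF equiv_reachable]]
      by (simp add: connected_components_eq)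
  qed
  moreover have "\<forall>v \<in> verts G - {v \<in> verts G. root v = v}. \<exists>w. (w, v) \<in> adj G \<and> f w < f v"
    using lower by blast
  ultimately show ?thesis
    by (rule that[of f "{v \<in> verts G. root v = v}"])
qed

text \<open>The extremal coloring uses ranks, hence colors in \<open>nat\<close>, while the bound is
  stated for an arbitrary color type \<open>'c\<close>. The subtraction is never truncated, as there
  are at most as many components as vertices.\<close>

theorem corollary1p9:
  fixes G :: "('v, 'e) multigraph" and n c :: nat
  assumes "finite_graph G" and "loopless G"
    and "n = card (verts G)" and "c = card (connected_components G)"
  shows "(\<exists>\<epsilon> :: 'e \<Rightarrow> nat. gallai_coloring G \<epsilon> \<and> num_colors G \<epsilon> = n - c) \<and>
         (\<forall>\<epsilon> :: 'e \<Rightarrow> 'c. gallai_coloring G \<epsilon> \<longrightarrow> num_colors G \<epsilon> \<le> n - c)"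
proof
  have fin: "finite (verts G)" "finite (edges G)"
    using assms(1) by (auto simp: finite_graph_def)
  obtain f :: "'v \<Rightarrow> nat" and R where f: "inj_on f (verts G)" and R: "R \<subseteq> verts G" "card R \<le> card (connected_components G)"
    and lower: "\<forall>v \<in> verts G - R. \<exists>w. (w, v) \<in> adj G \<and> f w < f v"
    by (rule ex_rank[OF fin(1)])
  define \<epsilon> where "\<epsilon> e = Max (f ` ends G e)" for e
  have gallai: "gallai_coloring G \<epsilon>"
    unfolding \<epsilon>_def using assms(2) by (rule gallai_coloring_Max_rank)
  have ge: "n - c \<le> num_colors G \<epsilon>"
  proof -
    \<comment> \<open>The edge from a vertex outside \<open>R\<close> to its lower neighbour has
      that vertex's rank as its color.\<close>
    have "f ` (verts G - R) \<subseteq> \<epsilon> ` edges G"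
    proof clarify
      fix v assume "v \<in> verts G" "v \<notin> R"
      then obtain w where "(w, v) \<in> adj G" "f w < f v"
        using lower by auto
      moreover from this obtain e where "e \<in> edges G" "ends G e = {w, v}"
        by (auto simp: adj_def)
      ultimately show "f v \<in> \<epsilon> ` edges G"
        by (intro image_eqI[of _ _ e]) (simp_all add: \<epsilon>_def)
    qed
    then have "card (f ` (verts G - R)) \<le> num_colors G \<epsilon>"
      unfolding num_colors_def using fin(2) by (simp add: card_mono)
    \<comment> \<open>Injectivity of \<open>f\<close> makes these ranks distinct colors.\<close>
    moreover have "card (f ` (verts G - R)) = n - card R"
      using card_image[OF inj_on_subset[OF f Diff_subset]]
        card_Diff_subset[OF finite_subset[OF R(1) fin(1)] R(1)] assms(3)
      by simp
    ultimately show ?thesis using R(2) assms(4) by simp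
  qed
  have "num_colors G \<epsilon> = n - c"
    using num_colors_le[OF assms(1,2) gallai] ge unfolding assms(3,4) by (rule le_antisym)
  with gallai show "\<exists>\<epsilon> :: 'e \<Rightarrow> nat. gallai_coloring G \<epsilon> \<and> num_colors G \<epsilon> = n - c"
    by blast
  show "\<forall>\<epsilon> :: 'e \<Rightarrow> 'c. gallai_coloring G \<epsilon> \<longrightarrow> num_colors G \<epsilon> \<le> n - c"
    unfolding assms(3,4) by (intro allI impI num_colors_le[OF assms(1,2)])
qed

end
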